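(* Let $\mu_1,\mu_2$ be an Angelesco system on $[a_1,b_1]$, $[a_2,b_2]$ with $b_1\le a_2$. (a) For every $n\ge1$ and $1\le j\le n$ one has $$\lambda_{j,2n}^{(1)}\ge\lambda_m(x_{j,2n};\mu_1),$$ where $m=\lceil 3n/2\rceil$ is the least integer $\ge 3n/2$ and $\lambda_m(x;\mu_1)$ is the Christoffel function of $\mu_1$. (b) If $J_1$ is a closed subinterval of $(a_1,b_1)$ and $\mu_1$ is absolutely continuous in an open neighborhood of $J_1$, while $\mu_1'$ is bounded from below by a positive constant there, then there is a constant $C_1>0$, independent of $j$ and $n$, such that $$\lambda_{j,2n}^{(1)}\ge\frac{C_1}{n}$$ whenever $1\le j\le n$ and $x_{j,2n}\in J_1$.
   Context: Setting: $-\infty<a_1<b_1\le a_2<b_2<\infty$, and $\mu_1,\mu_2$ are finite positive Borel measures with infinite support, $\mathrm{supp}(\mu_j)\subset[a_j,b_j]$ (an Angelesco system). For $n\ge1$, $P_{n,n}$ is the (unique) monic polynomial of degree $2n$ with $\int P_{n,n}(x)x^k\,d\mu_j(x)=0$ for $0\le k\le n-1$ and $j=1,2$. It is known that $P_{n,n}$ has $n$ simple zeros in $(a_1,b_1)$ and $n$ simple zeros in $(a_2,b_2)$; they are denoted in increasing order $x_{1,2n}<\dots<x_{n,2n}$ (in $(a_1,b_1)$) and $x_{n+1,2n}<\dots<x_{2n,2n}$ (in $(a_2,b_2)$). The quadrature weights are $\lambda_{k,2n}^{(j)}=\int \ell_{k,2n}(x)\,d\mu_j(x)$, $1\le k\le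 2n$, $j=1,2$, where $\ell_{k,2n}$ is the polynomial of degree at most $2n-1$ with $\ell_{k,2n}(x_{i,2n})=\delta_{i,k}$. Consequently $\sum_{k=1}^{2n}\lambda_{k,2n}^{(j)}P(x_{k,2n})=\int P\,d\mu_j$ for every polynomial $P$ of degree at most $3n-1$. The Christoffel function of a measure $\mu$ is $\lambda_m(x;\mu)=\bigl(\sum_{k=0}^{m-1}p_k^2(x;\mu)\bigr)^{-1}$, where $p_k(\cdot;\mu)$ is the orthonormal polynomial of degree $k$ for $\mu$. $\mu_1'$ is the density (Radon--Nikodym derivative) of the absolutely continuous part of $\mu_1$ with respect to Lebesgue measure. *)

theory Defs
  imports "HOL-Analysis.Analysis" "HOL-Computational_Algebra.Polynomial"
begin

definition measure_support :: "real measure \<Rightarrow> real set" where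
  "measure_support \<mu> = {x. \<forall>U. open U \<and> x \<in> U \<longrightarrow> 0 < emeasure \<mu> U}"

locale angelesco =
  \<mu>1: finite_measure \<mu>1 + \<mu>2: finite_measure \<mu>2
  for a1 b1 a2 b2 :: real and \<mu>1 \<mu>2 :: "real measure" +
  assumes intervals: "a1 < b1" "b1 \<le> a2" "a2 < b2"
    and borel_measures: "sets \<mu>1 = sets borel" "sets \<mu>2 = sets borel"
    and infinite_support: "infinite (measure_support \<mu>1)" "infinite (measure_support \<mu>2)"
    and support_subset: "measure_support \<mu>1 \<subseteq> {a1..b1}" "measure_support \<mu>2 \<subseteq> {a2..b2}"

text \<open>The diagonal type II multiple orthogonal polynomial \<open>P\<^bsub>n,n\<^esub>\<close>; it exists and is
  unique for an Angelesco system.\<close>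

definition multi_orth_poly :: "real measure \<Rightarrow> real measure \<Rightarrow> nat \<Rightarrow> real poly" where
  "multi_orth_poly \<mu>1 \<mu>2 n =
     (THE P. degree P = 2 * n \<and> lead_coeff P = 1 \<and>
        (\<forall>k<n. (\<integral>x. poly P x * x ^ k \<partial>\<mu>1) = 0) \<and>
        (\<forall>k<n. (\<integral>x. poly P x * x ^ k \<partial>\<mu>2) = 0))"

text \<open>\<open>multi_orth_zero \<mu>1 \<mu>2 n k\<close> is \<open>x\<^bsub>k,2n\<^esub>\<close>, for \<open>1 \<le> k \<le> 2n\<close>. Since
  \<open>b1 \<le> a2\<close>, numbering the \<open>n\<close> zeros in \<open>(a1, b1)\<close> increasingly and then those in
  \<open>(a2, b2)\<close> is the same as listing all the zeros in increasing order. List positions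
  start at \<open>0\<close>, hence the shift.\<close>

definition multi_orth_zero :: "real measure \<Rightarrow> real measure \<Rightarrow> nat \<Rightarrow> nat \<Rightarrow> real" where
  "multi_orth_zero \<mu>1 \<mu>2 n k =
     sorted_list_of_set {x. poly (multi_orth_poly \<mu>1 \<mu>2 n) x = 0} ! (k - 1)"

definition fundamental_poly :: "real measure \<Rightarrow> real measure \<Rightarrow> nat \<Rightarrow> nat \<Rightarrow> real poly" where
  "fundamental_poly \<mu>1 \<mu>2 n k =
     (THE l. degree l \<le> 2 * n - 1 \<and>
        (\<forall>i\<in>{1..2 * n}. poly l (multi_orth_zero \<mu>1 \<mu>2 n i) = (if i = k then 1 else 0)))"

text \<open>\<open>\<lambda>\<^bsub>k,2n\<^esub>\<^sup>(\<^sup>j\<^sup>)\<close> is \<open>quadrature_weight \<mu>1 \<mu>2 \<mu>j n k\<close>, for \<open>\<mu>j\<close> one of the two measures.\<close>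

definition quadrature_weight ::
  "real measure \<Rightarrow> real measure \<Rightarrow> real measure \<Rightarrow> nat \<Rightarrow> nat \<Rightarrow> real" where
  "quadrature_weight \<mu>1 \<mu>2 \<mu>j n k = (\<integral>x. poly (fundamental_poly \<mu>1 \<mu>2 n k) x \<partial>\<mu>j)"

text \<open>The sequence of orthonormal polynomials, normalized by positive leading coefficients,
  which makes it unique when the support is infinite and compact.\<close>

definition orthonormal_poly :: "real measure \<Rightarrow> nat \<Rightarrow> real poly" where
  "orthonormal_poly \<mu> =
     (THE p. (\<forall>k. degree (p k) = k \<and> 0 < lead_coeff (p k)) \<and>
        (\<forall>k l. (\<integral>x. poly (p k) x * poly (p l) x \<partial>\<mu>) = (if k = l then 1 else 0)))"

definition christoffel_fun :: "nat \<Rightarrow> real \<Rightarrow> real measure \<Rightarrow> real" where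
  "christoffel_fun m x \<mu> = inverse (\<Sum>k<m. (poly (orthonormal_poly \<mu> k) x)\<^sup>2)"

text \<open>\<open>w\<close> is a version of \<open>\<mu>'\<close>: the Lebesgue decomposition of \<open>\<mu>\<close> is \<open>w dx + \<nu>\<close> with
  \<open>\<nu>\<close> singular. Such a \<open>w\<close> is determined up to Lebesgue null sets.\<close>

definition is_ac_density :: "real measure \<Rightarrow> (real \<Rightarrow> ennreal) \<Rightarrow> bool" where
  "is_ac_density \<mu> w \<longleftrightarrow>
     w \<in> borel_measurable borel \<and>
     (\<exists>\<nu>. sets \<nu> = sets borel \<and>
        (\<exists>N\<in>null_sets lborel. emeasure \<nu> (- N) = 0) \<and>
        (\<forall>A\<in>sets borel. emeasure \<mu> A = emeasure (density lborel w) A + emeasure \<nu> A))"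

end

theory Submission
  imports Defs
begin

text \<open>
  Write \<open>x\<^sub>1 < \<dots> < x\<^sub>2\<^sub>n\<close> for the zeros of the multiple orthogonal polynomial \<open>P\<close> and
  \<open>\<lambda>\<^sub>k\<close> for the quadrature weights with respect to \<open>\<mu>1\<close>. Because \<open>P\<close> is orthogonal to degree
  \<open>n - 1\<close>, the interpolatory formula \<open>\<integral>R d\<mu>1 = \<Sum>\<^sub>k \<lambda>\<^sub>k R(x\<^sub>k)\<close> holds up to degree \<open>3n - 1\<close>
  (\<open>quadrature_exact\<close>), and everything follows from feeding it two kinds of test polynomials.

  The weights at the zeros in the second interval alternate in sign. For \<open>k > n\<close>, take
  \<open>R = p\<^sup>2 q\<close>, where \<open>p\<close> vanishes at \<open>x\<^sub>1, \<dots>, x\<^sub>n\<close> and \<open>q\<close> at all the remaining zeros but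
  \<open>x\<^sub>k\<close>. The degree is exactly \<open>3n - 1\<close>, the factor \<open>q\<close> has constant sign on \<open>[a1, b1]\<close>, and
  only the \<open>k\<close>-th term of the quadrature sum survives; hence the sign of \<open>\<lambda>\<^sub>k\<close> is determined by the
  parity of \<open>k - n\<close>, and it is nonpositive when \<open>k - n\<close> is even (\<open>quadrature_weight_nonpos\<close>).

  Fix \<open>j \<le> n\<close>. Let \<open>r\<close> vanish at the other zeros in the first interval and at those
  zeros \<open>x\<^sub>k\<close>, \<open>k > n\<close>, for which \<open>k - n\<close> is odd, and normalize \<open>r(x\<^sub>j) = 1\<close>. There are
  \<open>\<lceil>n/2\<rceil>\<close> indices of the second kind, so \<open>r\<close> has degree \<open>n - 1 + \<lceil>n/2\<rceil> < \<lceil>3n/2\<rceil> = m\<close>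
  and \<open>r\<^sup>2\<close> is within reach of the quadrature formula. Apart from \<open>\<lambda>\<^sub>j\<close>, only nonpositive
  weights are left in the sum, hence \<open>\<integral>r\<^sup>2 d\<mu>1 \<le> \<lambda>\<^sub>j\<close> (\<open>exists_test_poly\<close>).

  Both parts are lower bounds for that integral. For (a), the Christoffel function is the
  minimum of \<open>\<integral>r\<^sup>2 d\<mu>1\<close> over all \<open>r\<close> of degree below \<open>m\<close> with \<open>r(x) = 1\<close>
  (\<open>christoffel_fun_le\<close>). For (b), the integral is at least
  \<open>\<delta> \<integral>r(y)\<^sup>2 dy\<close> over \<open>[x - \<epsilon>, x + \<epsilon>]\<close> for an \<open>\<epsilon>\<close> that does not depend on \<open>x \<in> [c, d]\<close>.
  In the variable \<open>y = x - \<epsilon> cos t\<close> the polynomial becomes, after multiplication by \<open>sin t\<close>, a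
  sine polynomial with \<open>m\<close> terms, and Parseval with Cauchy--Schwarz gives the lower bound
  \<open>\<epsilon>\<pi>/(2m)\<close> (\<open>integral_square_poly_ge\<close>); finally \<open>m \<le> 2n\<close>.

  That \<open>P\<close> exists, is unique and has \<open>n\<close> zeros in each interval rests on one fact: a nonzero polynomial
  orthogonal to all lower powers than \<open>x\<^sup>n\<close> has at least \<open>n\<close> zeros inside the interval
  (\<open>orth_poly_many_roots\<close>).
\<close>

section \<open>Polynomials: sign changes, linear conditions, expansions\<close>

text \<open>The zeros of odd order, where \<open>p\<close> changes sign, form such a set \<open>Z\<close>. The induction avoids
  orders: splitting off a linear factor \<open>x - z\<close> from \<open>p\<close> toggles the membership of \<open>z\<close> in \<open>Z\<close>.
  The factor \<open>s\<close> is a sign.\<close>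
lemma sign_constant_completion:
  fixes p :: "real poly"
  assumes "p \<noteq> 0"
  shows "\<exists>Z s. finite Z \<and> Z \<subseteq> {x. a < x \<and> x < b \<and> poly p x = 0} \<and>
           s \<noteq> 0 \<and> (\<forall>x. a < x \<longrightarrow> x < b \<longrightarrow> 0 \<le> poly (smult s (p * (\<Prod>z\<in>Z. [:-z, 1:]))) x)"
  using assms
proof (induction "degree p" arbitrary: p rule: less_induct)
  case less
  show ?case
  proof (cases "\<exists>z. a < z \<and> z < b \<and> poly p z = 0")
    case False
    have "(\<forall>x. a < x \<longrightarrow> x < b \<longrightarrow> 0 \<le> poly p x) \<or> (\<forall>x. a < x \<longrightarrow> x < b \<longrightarrow> 0 \<le> - poly p x)"
    proof (rule ccontr)
      assume "\<not> ?thesis"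
      then obtain x y where xy: "a < x" "x < b" "poly p x < 0" "a < y" "y < b" "poly p y > 0"
        by (auto simp: not_le)
      then have "x \<noteq> y" by auto
      with xy have "\<exists>z. a < z \<and> z < b \<and> poly p z = 0"
        using poly_IVT_pos[of x y p] poly_IVT_neg[of y x p] by (meson linorder_neqE less_trans)
      with False show False by blast
    qed
    then show ?thesis
    proof
      assume "\<forall>x. a < x \<longrightarrow> x < b \<longrightarrow> 0 \<le> poly p x"
      then show ?thesis by (intro exI[of _ "{}"] exI[of _ 1]) auto
    next
      assume "\<forall>x. a < x \<longrightarrow> x < b \<longrightarrow> 0 \<le> - poly p x"
      then show ?thesis by (intro exI[of _ "{}"] exI[of _ "-1"]) auto
    qed
  next
    case True
    then obtain z where z: "a < z" "z < b" "poly p z = 0" by blast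
    then obtain q where q: "p = [:-z, 1:] * q" by (metis dvdE poly_eq_0_iff_dvd)
    with less.prems have "q \<noteq> 0" by auto
    then have "degree q < degree p" unfolding q by (subst degree_mult_eq) auto
    from less.hyps[OF this \<open>q \<noteq> 0\<close>] obtain Z s where Z: "finite Z"
      "Z \<subseteq> {x. a < x \<and> x < b \<and> poly q x = 0}" "s \<noteq> 0"
      "\<And>x. a < x \<Longrightarrow> x < b \<Longrightarrow> 0 \<le> poly (smult s (q * (\<Prod>z\<in>Z. [:-z, 1:]))) x" by blast
    show ?thesis
    proof (cases "z \<in> Z")
      case True
      have "p * (\<Prod>z\<in>Z-{z}. [:-z, 1:]) = q * (\<Prod>z\<in>Z. [:-z, 1:])"
        unfolding q using prod.remove[OF Z(1) True, of "\<lambda>z. [:-z, 1:]"] by (simp only: mult_ac)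
      then show ?thesis using Z q
        by (intro exI[of _ "Z - {z}"] exI[of _ s]) auto
    next
      case False
      have "p * (\<Prod>z\<in>insert z Z. [:-z, 1:]) = [:-z, 1:] ^ 2 * (q * (\<Prod>z\<in>Z. [:-z, 1:]))"
        unfolding q prod.insert[OF Z(1) False] by (simp only: mult_ac power2_eq_square)
      then have "poly (smult s (p * (\<Prod>z\<in>insert z Z. [:-z, 1:]))) x
          = (x - z)^2 * poly (smult s (q * (\<Prod>z\<in>Z. [:-z, 1:]))) x" for x
        by (simp add: algebra_simps)
      then show ?thesis using Z q z
        by (intro exI[of _ "insert z Z"] exI[of _ s]) (auto simp del: poly_smult mult_pCons_left)
    qed
  qed
qed

text \<open>Gaussian elimination: the last equation is used to eliminate one unknown \<open>p\<close> from the others.\<close>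
lemma underdetermined_system:
  fixes A :: "nat \<Rightarrow> 'b \<Rightarrow> 'a :: field"
  assumes "finite J" "N < card J"
  shows "\<exists>c. (\<exists>j\<in>J. c j \<noteq> 0) \<and> (\<forall>i<N. (\<Sum>j\<in>J. A i j * c j) = 0)"
  using assms
proof (induction N arbitrary: A J)
  case 0
  then show ?case by (intro exI[of _ "\<lambda>_. 1"]) (auto simp: card_gt_0_iff)
next
  case (Suc N)
  show ?case
  proof (cases "\<forall>j\<in>J. A N j = 0")
    case True
    then show ?thesis using Suc.IH[of J A] Suc.prems by (auto simp: less_Suc_eq)
  next
    case False
    then obtain p where p: "p \<in> J" "A N p \<noteq> 0" by blast
    define A' where "A' i j = A i j - A i p * A N j / A N p" for i j
    have "N < card (J - {p})" using Suc.prems p by simp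
    then obtain c where c: "\<exists>j\<in>J-{p}. c j \<noteq> 0" "\<And>i. i < N \<Longrightarrow> (\<Sum>j\<in>J-{p}. A' i j * c j) = 0"
      using Suc.IH[of "J - {p}" A'] Suc.prems by auto
    define c' where "c' = c(p := - (\<Sum>j\<in>J-{p}. A N j * c j) / A N p)"
    have sum: "(\<Sum>j\<in>J. A i j * c' j) = A i p * c' p + (\<Sum>j\<in>J-{p}. A i j * c j)" for i
      using sum.remove[OF Suc.prems(1) p(1), of "\<lambda>j. A i j * c' j"]
      by (simp add: c'_def)
    have "(\<Sum>j\<in>J. A i j * c' j) = 0" if "i < Suc N" for i
    proof (cases "i = N")
      case True
      then show ?thesis using p unfolding sum by (simp add: c'_def)
    next
      case False
      have "(\<Sum>j\<in>J-{p}. A' i j * c j)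
          = (\<Sum>j\<in>J-{p}. A i j * c j) - A i p / A N p * (\<Sum>j\<in>J-{p}. A N j * c j)"
        by (simp add: A'_def left_diff_distrib right_diff_distrib sum_subtractf sum_distrib_left mult_ac)
      with c(2)[of i] False that show ?thesis unfolding sum by (simp add: c'_def)
    qed
    moreover have "\<exists>j\<in>J. c' j \<noteq> 0" using c(1) by (auto simp: c'_def)
    ultimately show ?thesis by blast
  qed
qed

text \<open>The space of polynomials of degree at most \<open>N\<close> has dimension \<open>N + 1\<close>. Both the orthonormal and
  the multiple orthogonal polynomials are obtained from this.\<close>
lemma exists_nonzero_poly_annihilated:
  fixes L :: "nat \<Rightarrow> real poly \<Rightarrow> real"
  assumes add: "\<And>i p q. L i (p + q) = L i p + L i q"
    and smult: "\<And>i c p. L i (smult c p) = c * L i p"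
  shows "\<exists>p. p \<noteq> 0 \<and> degree p \<le> N \<and> (\<forall>i<N. L i p = 0)"
proof -
  obtain c where c: "\<exists>j\<in>{..N}. c j \<noteq> 0" "\<And>i. i < N \<Longrightarrow> (\<Sum>j\<le>N. L i (monom 1 j) * c j) = 0"
    using underdetermined_system[of "{..N}" N "\<lambda>i j. L i (monom 1 j)"] by auto
  define p where "p = (\<Sum>j\<le>N. smult (c j) (monom 1 j))"
  have "L i 0 = 0" for i using smult[of i 0 0] by simp
  then have "L i (\<Sum>j\<in>J. smult (c j) (monom 1 j)) = (\<Sum>j\<in>J. L i (monom 1 j) * c j)" for i J
    by (induction J rule: infinite_finite_induct) (auto simp: add smult)
  then have "\<forall>i<N. L i p = 0" using c(2) by (simp add: p_def)
  moreover have co: "coeff p j = (if j \<le> N then c j else 0)" for j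
    by (simp add: p_def coeff_sum if_distrib[of "\<lambda>x. c _ * x"] smult_monom)
  then have "degree p \<le> N" by (intro degree_le) auto
  moreover from co c(1) have "p \<noteq> 0" by (metis atMost_iff coeff_0)
  ultimately show ?thesis by blast
qed

text \<open>The vanishing of the coefficients from \<open>m\<close> on expresses \<open>degree r < m\<close> in a form that for
  \<open>m = 0\<close> leaves only \<open>r = 0\<close>; the same form is used for orthogonality below.\<close>
lemma expand_in_graded_basis:
  fixes p :: "nat \<Rightarrow> 'a :: field poly"
  assumes "\<And>k. degree (p k) = k" "\<And>k. lead_coeff (p k) \<noteq> 0" "\<And>i. i \<ge> m \<Longrightarrow> coeff r i = 0"
  shows "\<exists>c. r = (\<Sum>k<m. smult (c k) (p k))"
  using assms(3)
proof (induction m arbitrary: r)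
  case 0
  then show ?case by (auto simp: poly_eq_iff)
next
  case (Suc m)
  define d where "d = coeff r m / lead_coeff (p m)"
  have "coeff (r - smult d (p m)) i = 0" if "i \<ge> m" for i
    using Suc.prems[of i] assms(1)[of m] assms(2)[of m] that
    by (cases "i = m") (auto simp: d_def coeff_eq_0)
  from Suc.IH[OF this] obtain c where "r - smult d (p m) = (\<Sum>k<m. smult (c k) (p k))" by blast
  then show ?case
    by (intro exI[of _ "c(m := d)"]) (simp add: algebra_simps)
qed

section \<open>Measures with infinite compact support\<close>

text \<open>The complement of the support is a union of open null sets; a countable base of the topology
  makes it a countable union.\<close>
lemma AE_in_measure_support:
  assumes "sets M = sets borel"
  shows "AE x in M. x \<in> measure_support M"
proof -
  obtain B :: "real set set" where B: "countable B" "topological_basis B"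
    using ex_countable_basis by blast
  define N where "N = \<Union>{b \<in> B. emeasure M b = 0}"
  have "N \<in> null_sets M"
    unfolding N_def using B assms
    by (intro null_sets_UN'[where N = "\<lambda>b. b" and I = "{b \<in> B. emeasure M b = 0}", simplified])
       (auto simp: null_sets_def topological_basis_open)
  moreover have "{x \<in> space M. x \<notin> measure_support M} \<subseteq> N"
  proof
    fix x assume "x \<in> {x \<in> space M. x \<notin> measure_support M}"
    then obtain U where U: "open U" "x \<in> U" "emeasure M U = 0"
      by (auto simp: measure_support_def zero_less_iff_neq_zero)
    obtain b where b: "b \<in> B" "x \<in> b" "b \<subseteq> U"
      using topological_basisE[OF B(2) U(1,2)] by blast
    have "emeasure M b \<le> emeasure M U"
      using b U assms by (intro emeasure_mono) auto
    with b U show "x \<in> N" by (auto simp: N_def)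
  qed
  ultimately show ?thesis by (rule AE_I')
qed

locale infinite_compact_measure = finite_measure \<mu> for \<mu> :: "real measure" and a b :: real +
  assumes sets_borel: "sets \<mu> = sets borel"
    and inf_support: "infinite (measure_support \<mu>)"
    and supp_subset: "measure_support \<mu> \<subseteq> {a..b}"
begin

lemma AE_interval: "AE x in \<mu>. a \<le> x \<and> x \<le> b"
  using AE_in_measure_support[OF sets_borel] by eventually_elim (use supp_subset in auto)

lemma integrable_poly [simp, intro]: "integrable \<mu> (poly p)"
proof -
  have "bounded (poly p ` {a..b})"
    by (intro compact_imp_bounded compact_continuous_image continuous_intros) auto
  then obtain B where B: "\<forall>x\<in>{a..b}. norm (poly p x) \<le> B"
    unfolding bounded_iff by (auto simp: ball_simps)
  have "AE x in \<mu>. norm (poly p x) \<le> B"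
    using AE_interval by eventually_elim (use B in auto)
  moreover have "poly p \<in> borel_measurable \<mu>"
    unfolding measurable_cong_sets[OF sets_borel refl]
    by (intro borel_measurable_continuous_onI continuous_on_poly continuous_on_id)
  ultimately show ?thesis by (intro integrable_const_bound)
qed

text \<open>Otherwise the support would be contained in the finite zero set of \<open>p\<close>. This is what makes
  \<open>(p, q) \<mapsto> \<integral>pq d\<mu>\<close> an inner product on all polynomials.\<close>
lemma poly_eq_0_of_AE:
  assumes "AE x in \<mu>. poly p x = 0"
  shows "p = 0"
proof (rule ccontr)
  assume "p \<noteq> 0"
  then have fin: "finite {x. poly p x = 0}" by (rule poly_roots_finite)
  have "measure_support \<mu> \<subseteq> {x. poly p x = 0}"
  proof
    fix x assume x: "x \<in> measure_support \<mu>"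
    show "x \<in> {x. poly p x = 0}"
    proof (rule ccontr)
      assume "x \<notin> {x. poly p x = 0}"
      moreover have op: "open (- {x. poly p x = 0})" using fin by (simp add: finite_imp_closed open_Compl)
      ultimately have "0 < emeasure \<mu> (- {x. poly p x = 0})"
        using x unfolding measure_support_def by blast
      moreover have "- {x. poly p x = 0} \<in> null_sets \<mu>"
        using assms op sets_borel by (subst AE_iff_null_sets) auto
      ultimately show False by (simp add: null_setsD1)
    qed
  qed
  with fin inf_support show False using finite_subset by blast
qed

lemma nonneg_poly_integral_0:
  assumes "\<And>x. a < x \<Longrightarrow> x < b \<Longrightarrow> 0 \<le> poly p x" "a < b" "(\<integral>x. poly p x \<partial>\<mu>) = 0"
  shows "p = 0"
proof (rule poly_eq_0_of_AE)
  have "{a..b} \<subseteq> poly p -` {0..}"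
  proof -
    have "closure {a<..<b} \<subseteq> poly p -` {0..}"
      by (rule closure_minimal) (use assms(1) in \<open>auto intro!: continuous_closed_vimage\<close>)
    with assms(2) show ?thesis by simp
  qed
  then have "AE x in \<mu>. 0 \<le> poly p x"
    by (intro eventually_mono[OF AE_interval]) auto
  then show "AE x in \<mu>. poly p x = 0"
    using integral_nonneg_eq_0_iff_AE[OF integrable_poly] assms(3) by blast
qed

lemma orth_lower_degree:
  assumes "\<And>k. k < n \<Longrightarrow> (\<integral>x. poly p x * x ^ k \<partial>\<mu>) = 0" "\<And>k. k \<ge> n \<Longrightarrow> coeff q k = 0"
  shows "(\<integral>x. poly (p * q) x \<partial>\<mu>) = 0"
proof -
  have int: "integrable \<mu> (\<lambda>x. poly p x * x ^ k)" for k
    using integrable_poly[of "p * monom 1 k"] by (simp add: poly_monom[abs_def] poly_mult[abs_def])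
  have q: "poly q x = (\<Sum>k<n. coeff q k * x ^ k)" for x
  proof -
    have "poly q x = (\<Sum>k\<le>degree q. coeff q k * x ^ k)" by (simp add: poly_altdef)
    also have "\<dots> = (\<Sum>k<n. coeff q k * x ^ k)"
      by (rule sum.mono_neutral_cong) (use assms(2) in \<open>auto simp: coeff_eq_0\<close>)
    finally show ?thesis .
  qed
  have "(\<integral>x. poly (p * q) x \<partial>\<mu>) = (\<integral>x. (\<Sum>k<n. coeff q k * (poly p x * x ^ k)) \<partial>\<mu>)"
    by (simp add: q sum_distrib_left mult_ac)
  also have "\<dots> = (\<Sum>k<n. coeff q k * (\<integral>x. poly p x * x ^ k \<partial>\<mu>))"
    by (subst Bochner_Integration.integral_sum) (auto intro!: integrable_mult_right int)
  also have "\<dots> = 0" using assms(1) by simp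
  finally show ?thesis .
qed

end

text \<open>If \<open>p\<close> had fewer than \<open>n\<close> sign changes, the product of the corresponding linear factors would
  be a polynomial of degree below \<open>n\<close>, hence orthogonal to \<open>p\<close>, although its product with \<open>p\<close> has
  constant sign.\<close>
lemma (in infinite_compact_measure) orth_poly_many_roots:
  assumes "\<And>k. k < n \<Longrightarrow> (\<integral>x. poly p x * x ^ k \<partial>\<mu>) = 0" "p \<noteq> 0" "a < b"
  shows "n \<le> card {x. a < x \<and> x < b \<and> poly p x = 0}"
proof -
  obtain Z s where Z: "finite Z" "Z \<subseteq> {x. a < x \<and> x < b \<and> poly p x = 0}" "s \<noteq> 0"
    "\<And>x. a < x \<Longrightarrow> x < b \<Longrightarrow> 0 \<le> poly (smult s (p * (\<Prod>z\<in>Z. [:-z, 1:]))) x"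
    using sign_constant_completion[OF assms(2), of a b] by blast
  define q where "q = (\<Prod>z\<in>Z. [:-z, 1:])"
  have "q \<noteq> 0" using Z(1) by (auto simp: q_def)
  have deg: "degree q = card Z"
    unfolding q_def by (subst degree_prod_eq_sum_degree) auto
  have "n \<le> card Z"
  proof (rule ccontr)
    assume "\<not> ?thesis"
    then have "(\<integral>x. poly (p * q) x \<partial>\<mu>) = 0"
      using assms(1) deg by (intro orth_lower_degree[where n = n]) (auto intro: coeff_eq_0)
    then have "(\<integral>x. poly (smult s (p * q)) x \<partial>\<mu>) = 0" by simp
    then have "smult s (p * q) = 0"
      using nonneg_poly_integral_0[of "smult s (p * q)"] Z(4) assms(3) by (auto simp: q_def)
    with assms(2) \<open>s \<noteq> 0\<close> \<open>q \<noteq> 0\<close> show False by auto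
  qed
  also have "card Z \<le> card {x. a < x \<and> x < b \<and> poly p x = 0}"
    using Z(2) poly_roots_finite[OF assms(2)]
    by (intro card_mono) (auto elim: finite_subset[rotated])
  finally show ?thesis .
qed

section \<open>Orthonormal polynomials and the Christoffel function\<close>

context infinite_compact_measure
begin

lemma integral_poly_add: "(\<integral>x. poly (p + q) x \<partial>\<mu>) = (\<integral>x. poly p x \<partial>\<mu>) + (\<integral>x. poly q x \<partial>\<mu>)"
  by (simp add: poly_add[abs_def] Bochner_Integration.integral_add[OF integrable_poly integrable_poly])

lemma integral_poly_smult: "(\<integral>x. poly (smult c p) x \<partial>\<mu>) = c * (\<integral>x. poly p x \<partial>\<mu>)"
  by (simp add: poly_smult[abs_def])

lemma integral_poly_diff: "(\<integral>x. poly (p - q) x \<partial>\<mu>) = (\<integral>x. poly p x \<partial>\<mu>) - (\<integral>x. poly q x \<partial>\<mu>)"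
  by (simp add: poly_diff[abs_def] Bochner_Integration.integral_diff[OF integrable_poly integrable_poly])

lemma integral_poly_sum: "(\<integral>x. poly (\<Sum>i\<in>I. f i) x \<partial>\<mu>) = (\<Sum>i\<in>I. \<integral>x. poly (f i) x \<partial>\<mu>)"
  by (simp add: poly_sum[abs_def] Bochner_Integration.integral_sum[OF integrable_poly])

lemma integral_square_eq_0_iff:
  assumes "a < b"
  shows "(\<integral>x. poly (p * p) x \<partial>\<mu>) = 0 \<longleftrightarrow> p = 0"
  using nonneg_poly_integral_0[of "p * p"] assms by auto

definition orthonormal_sequence :: "(nat \<Rightarrow> real poly) \<Rightarrow> bool" where
  "orthonormal_sequence p \<longleftrightarrow> (\<forall>k. degree (p k) = k \<and> 0 < lead_coeff (p k)) \<and>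
     (\<forall>k l. (\<integral>x. poly (p k) x * poly (p l) x \<partial>\<mu>) = (if k = l then 1 else 0))"

text \<open>Imposing the \<open>k\<close> orthogonality conditions on polynomials of degree at most \<open>k\<close> leaves a nonzero
  solution \<open>p\<close>. Its degree is exactly \<open>k\<close>, for otherwise it would be orthogonal to itself.\<close>
lemma exists_orthonormal_poly:
  assumes "a < b"
  shows "\<exists>p. degree p = k \<and> 0 < lead_coeff p \<and> (\<integral>x. poly (p * p) x \<partial>\<mu>) = 1 \<and>
           (\<forall>q. (\<forall>i\<ge>k. coeff q i = 0) \<longrightarrow> (\<integral>x. poly (p * q) x \<partial>\<mu>) = 0)"
proof -
  obtain p where p: "p \<noteq> 0" "degree p \<le> k" "\<And>i. i < k \<Longrightarrow> (\<integral>x. poly (p * monom 1 i) x \<partial>\<mu>) = 0"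
    using exists_nonzero_poly_annihilated[of "\<lambda>i p. \<integral>x. poly (p * monom 1 i) x \<partial>\<mu>" k]
    by (auto simp: ring_distribs integral_poly_add integral_poly_smult simp del: poly_mult poly_add poly_smult)
  have orth: "(\<integral>x. poly (p * q) x \<partial>\<mu>) = 0" if "\<forall>i\<ge>k. coeff q i = 0" for q
    using p(3) that by (intro orth_lower_degree[where n = k]) (auto simp: poly_monom)
  have deg: "degree p = k"
    using orth[of p] integral_square_eq_0_iff[OF assms, of p] p(1,2) by (metis coeff_eq_0 le_neq_implies_less order_less_le_trans)
  define N where "N = (\<integral>x. poly (p * p) x \<partial>\<mu>)"
  have "N \<noteq> 0" using integral_square_eq_0_iff[OF assms] p(1) by (simp add: N_def del: poly_mult)
  moreover have "N \<ge> 0" unfolding N_def by (intro Bochner_Integration.integral_nonneg) auto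
  ultimately have N: "N > 0" by simp
  define c where "c = sgn (lead_coeff p) / sqrt N"
  have lc: "lead_coeff p \<noteq> 0" using p(1) by simp
  then have "lead_coeff p < 0 \<or> lead_coeff p > 0" by (rule linorder_neqE) auto
  then have c: "c \<noteq> 0" "c * c = 1 / N" "0 < c * lead_coeff p"
    using N by (auto simp: c_def sgn_if field_simps)
  show ?thesis
  proof (intro exI[of _ "smult c p"] conjI allI impI)
    show "(\<integral>x. poly (smult c p * smult c p) x \<partial>\<mu>) = 1"
      using c N by (simp add: integral_poly_smult N_def del: poly_mult poly_smult flip: mult.assoc)
  qed (use deg c orth in \<open>auto simp: integral_poly_smult simp del: poly_mult poly_smult\<close>)
qed

lemma exists_orthonormal_sequence:
  assumes "a < b" shows "\<exists>p. orthonormal_sequence p"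
proof -
  obtain p where p: "\<And>k. degree (p k) = k \<and> 0 < lead_coeff (p k) \<and> (\<integral>x. poly (p k * p k) x \<partial>\<mu>) = 1 \<and>
           (\<forall>q. (\<forall>i\<ge>k. coeff q i = 0) \<longrightarrow> (\<integral>x. poly (p k * q) x \<partial>\<mu>) = 0)"
    using exists_orthonormal_poly[OF assms] by metis
  have lt: "(\<integral>x. poly (p k) x * poly (p l) x \<partial>\<mu>) = 0" if "l < k" for k l
    using p[of k] p[of l] that by (simp add: poly_mult[abs_def] coeff_eq_0)
  have "(\<integral>x. poly (p k) x * poly (p l) x \<partial>\<mu>) = (if k = l then 1 else 0)" for k l
    using lt[of k l] lt[of l k] p[of k] by (cases k l rule: linorder_cases) (auto simp: mult.commute)
  with p show ?thesis unfolding orthonormal_sequence_def by blast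
qed


lemma orthonormal_sequence_coeff:
  assumes "orthonormal_sequence p" "l < m"
  shows "(\<integral>x. poly (p l * (\<Sum>k<m. smult (c k) (p k))) x \<partial>\<mu>) = c l"
proof -
  have "(\<integral>x. poly (p l * (\<Sum>k<m. smult (c k) (p k))) x \<partial>\<mu>) = (\<Sum>k<m. c k * (\<integral>x. poly (p l * p k) x \<partial>\<mu>))"
    by (simp add: sum_distrib_left integral_poly_sum integral_poly_smult del: poly_mult poly_smult)
  also have "\<dots> = (\<Sum>k<m. if l = k then c k else 0)"
    using assms(1) by (intro sum.cong) (auto simp: orthonormal_sequence_def poly_mult[abs_def])
  finally show ?thesis using assms(2) by simp
qed

lemma orthonormal_sequence_orth_lower:
  assumes "orthonormal_sequence p" "\<And>i. i \<ge> k \<Longrightarrow> coeff q i = 0"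
  shows "(\<integral>x. poly (p k * q) x \<partial>\<mu>) = 0"
proof -
  obtain c where "q = (\<Sum>i<k. smult (c i) (p i))"
    using expand_in_graded_basis[of p k q] assms unfolding orthonormal_sequence_def by (metis less_irrefl)
  then have "q = (\<Sum>i<Suc k. smult ((c(k := 0)) i) (p i))" by simp
  then show ?thesis using orthonormal_sequence_coeff[OF assms(1), of k "Suc k" "c(k := 0)"]
    by (metis fun_upd_same lessI)
qed

text \<open>Subtracting the multiple of \<open>q k\<close> that cancels the leading term leaves a polynomial of degree below
  \<open>k\<close>, to which both \<open>p k\<close> and \<open>q k\<close> are orthogonal; it is orthogonal to itself and vanishes.\<close>
lemma orthonormal_sequence_unique:
  assumes "orthonormal_sequence p" "orthonormal_sequence q" "a < b"
  shows "p = q"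
proof
  fix k
  define c where "c = lead_coeff (p k) / lead_coeff (q k)"
  define d where "d = p k - smult c (q k)"
  have pk: "degree (p k) = k" "0 < lead_coeff (p k)" "degree (q k) = k" "0 < lead_coeff (q k)"
    using assms(1,2) unfolding orthonormal_sequence_def by blast+
  then have "c > 0" by (simp add: c_def)
  have low: "coeff d i = 0" if "i \<ge> k" for i
    using pk that by (cases "i = k") (auto simp: d_def c_def coeff_eq_0)
  have "(\<integral>x. poly (d * d) x \<partial>\<mu>) = (\<integral>x. poly (p k * d) x \<partial>\<mu>) - c * (\<integral>x. poly (q k * d) x \<partial>\<mu>)"
    by (subst (1) d_def) (simp add: left_diff_distrib integral_poly_diff integral_poly_smult del: poly_mult poly_smult poly_diff)
  also have "\<dots> = 0"
    using orthonormal_sequence_orth_lower[OF assms(1) low] orthonormal_sequence_orth_lower[OF assms(2) low] by simp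
  finally have "d = 0" using integral_square_eq_0_iff[OF assms(3)] by blast
  then have eq: "p k = smult c (q k)" by (simp add: d_def)
  have "(\<integral>x. poly (p k * p k) x \<partial>\<mu>) = 1" "(\<integral>x. poly (q k * q k) x \<partial>\<mu>) = 1"
    using assms(1,2) by (auto simp: orthonormal_sequence_def poly_mult[abs_def])
  then have "c * c = 1" unfolding eq by (simp add: integral_poly_smult del: poly_mult poly_smult)
  with \<open>c > 0\<close> have "c = 1" by (simp add: square_eq_1_iff)
  with eq show "p k = q k" by simp
qed

lemma orthonormal_sequence_orthonormal_poly:
  assumes "a < b"
  shows "orthonormal_sequence (orthonormal_poly \<mu>)"
proof -
  have "orthonormal_poly \<mu> = (THE p. orthonormal_sequence p)"
    by (simp add: orthonormal_poly_def orthonormal_sequence_def)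
  moreover have "\<exists>!p. orthonormal_sequence p"
    using exists_orthonormal_sequence[OF assms] orthonormal_sequence_unique[OF _ _ assms] by blast
  ultimately show ?thesis by (simp add: theI')
qed

text \<open>The extremal property of the Christoffel function: with \<open>r = \<Sum> c\<^sub>k p\<^sub>k\<close> the integral is
  \<open>\<Sum> c\<^sub>k\<^sup>2\<close>, and Cauchy--Schwarz applies to \<open>1 = \<Sum> c\<^sub>k p\<^sub>k(x)\<close>.\<close>
lemma christoffel_fun_le:
  assumes "a < b" "m \<ge> 1" "degree r < m" "poly r x = 1"
  shows "christoffel_fun m x \<mu> \<le> (\<integral>y. poly (r * r) y \<partial>\<mu>)"
proof -
  define p where "p = orthonormal_poly \<mu>"
  have p: "orthonormal_sequence p"
    using orthonormal_sequence_orthonormal_poly[OF assms(1)] by (simp add: p_def)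
  obtain c where c: "r = (\<Sum>k<m. smult (c k) (p k))"
    using expand_in_graded_basis[of p m r] p assms(3) unfolding orthonormal_sequence_def
    by (metis coeff_eq_0 less_irrefl order_less_le_trans)
  have "(\<integral>y. poly (r * r) y \<partial>\<mu>) = (\<Sum>k<m. c k * (\<integral>y. poly (p k * r) y \<partial>\<mu>))"
    by (subst (1) c) (simp add: sum_distrib_right integral_poly_sum integral_poly_smult del: poly_mult poly_smult)
  also have "\<dots> = (\<Sum>k<m. (c k)\<^sup>2)"
    using orthonormal_sequence_coeff[OF p] c by (intro sum.cong) (auto simp: power2_eq_square)
  finally have int: "(\<integral>y. poly (r * r) y \<partial>\<mu>) = (\<Sum>k<m. (c k)\<^sup>2)" .
  have "1 = (\<Sum>k<m. c k * poly (p k) x)\<^sup>2"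
    using assms(4) by (subst (asm) c) (simp add: poly_sum)
  also have "\<dots> \<le> (\<Sum>k<m. (c k)\<^sup>2) * (\<Sum>k<m. (poly (p k) x)\<^sup>2)"
    by (rule Cauchy_Schwarz_ineq_sum)
  finally have 1: "1 \<le> (\<Sum>k<m. (c k)\<^sup>2) * (\<Sum>k<m. (poly (p k) x)\<^sup>2)" .
  then have "(\<Sum>k<m. (poly (p k) x)\<^sup>2) \<noteq> 0" by (metis mult_zero_right not_one_le_zero)
  then have "0 < (\<Sum>k<m. (poly (p k) x)\<^sup>2)" using sum_nonneg[of "{..<m}" "\<lambda>k. (poly (p k) x)\<^sup>2"] by fastforce
  with 1 show ?thesis
    unfolding christoffel_fun_def int p_def[symmetric] by (simp add: field_simps)
qed

end

section \<open>A mean-square lower bound for polynomial values\<close>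

text \<open>Chebyshev polynomials of the second kind.\<close>
fun chebyshev_U :: "nat \<Rightarrow> real poly" where
  "chebyshev_U 0 = 1"
| "chebyshev_U (Suc 0) = [:0, 2:]"
| "chebyshev_U (Suc (Suc k)) = [:0, 2:] * chebyshev_U (Suc k) - chebyshev_U k"

lemma chebyshev_U_cos: "poly (chebyshev_U k) (cos t) * sin t = sin (real (Suc k) * t)"
proof (induction k rule: chebyshev_U.induct)
  case (3 k)
  have "sin (real (Suc (Suc (Suc k))) * t) + sin (real (Suc k) * t) = 2 * sin (real (Suc (Suc k)) * t) * cos t"
    by (subst sin_plus_sin) (simp add: algebra_simps add_divide_distrib)
  with 3 show ?case by (simp add: algebra_simps)
qed (simp_all add: sin_double)

lemma degree_chebyshev_U: "degree (chebyshev_U k) = k \<and> lead_coeff (chebyshev_U k) \<noteq> 0"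
proof -
  have "(\<forall>i>k. coeff (chebyshev_U k) i = 0) \<and> coeff (chebyshev_U k) k = 2 ^ k"
  proof (induction k rule: chebyshev_U.induct)
    case (3 k)
    then show ?case by (auto simp: coeff_pCons split: nat.splits)
  qed (auto simp: coeff_pCons split: nat.splits)
  then have "degree (chebyshev_U k) = k"
    by (intro antisym degree_le le_degree) auto
  then show ?thesis using \<open>_ \<and> coeff (chebyshev_U k) k = 2 ^ k\<close> by auto
qed

lemma has_integral_sin_sin:
  "((\<lambda>t. sin (real (Suc k) * t) * sin (real (Suc l) * t)) has_integral (if k = l then pi / 2 else 0)) {0..pi}"
proof -
  have cos_int: "((\<lambda>t. cos (of_int c * t)) has_integral (if c = 0 then pi else 0)) {0..pi}" for c :: int
  proof (cases "c = 0")
    case True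
    then show ?thesis using has_integral_const_real[of "1::real" 0 pi] by simp
  next
    case False
    have "((\<lambda>t. cos (of_int c * t)) has_integral
        (sin (of_int c * pi) / of_int c - sin (of_int c * 0) / of_int c)) {0..pi}"
      using False
      by (intro fundamental_theorem_of_calculus)
         (auto intro!: derivative_eq_intros simp flip: has_real_derivative_iff_has_vector_derivative)
    then show ?thesis using False by (simp add: mult.commute[of _ pi] sin_integer_2pi sin_zero_iff_int2) 
  qed
  have "((\<lambda>t. (cos (of_int (int k - int l) * t) - cos (of_int (int k + int l + 2) * t)) / 2) has_integral
      ((if int k - int l = 0 then pi else 0) - (if int k + int l + 2 = 0 then pi else 0)) / 2) {0..pi}"
    by (intro has_integral_divide has_integral_diff cos_int)
  also have "(\<lambda>t. (cos (of_int (int k - int l) * t) - cos (of_int (int k + int l + 2) * t)) / 2)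
      = (\<lambda>t. sin (real (Suc k) * t) * sin (real (Suc l) * t))"
    by (simp add: sin_times_sin algebra_simps)
  finally show ?thesis by (simp split: if_splits)
qed

lemma has_integral_square_sine_poly:
  "((\<lambda>t. (\<Sum>k<m. c k * sin (real (Suc k) * t))\<^sup>2) has_integral pi / 2 * (\<Sum>k<m. (c k)\<^sup>2)) {0..pi}"
proof -
  have "((\<lambda>t. \<Sum>k<m. \<Sum>l<m. c k * c l * (sin (real (Suc k) * t) * sin (real (Suc l) * t))) has_integral
      (\<Sum>k<m. \<Sum>l<m. c k * c l * (if k = l then pi / 2 else 0))) {0..pi}"
    by (intro has_integral_sum has_integral_mult_right has_integral_sin_sin) auto
  moreover have "(\<Sum>k<m. \<Sum>l<m. c k * c l * (if k = l then pi / 2 else 0)) = pi / 2 * (\<Sum>k<m. (c k)\<^sup>2)"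
    by (simp add: sum_distrib_left power2_eq_square if_distrib cong: if_cong) (simp add: mult_ac)
  moreover have "(\<Sum>k<m. \<Sum>l<m. c k * c l * (sin (real (Suc k) * t) * sin (real (Suc l) * t)))
      = (\<Sum>k<m. c k * sin (real (Suc k) * t))\<^sup>2" for t
    by (simp add: power2_eq_square sum_product mult_ac del: of_nat_Suc)
  ultimately show ?thesis by simp
qed

text \<open>The substitution \<open>y = x - \<epsilon> cos t\<close> turns the integral into
  \<open>\<epsilon> \<integral> q(cos t)\<^sup>2 sin t dt\<close> over \<open>[0, \<pi>]\<close>. Replacing \<open>sin t\<close> by the smaller \<open>(sin t)\<^sup>2\<close> amounts
  to passing to the Chebyshev weight of the second kind, for which \<open>q(cos t) sin t\<close> is a
  sine polynomial. The centre \<open>x\<close> corresponds to \<open>t = \<pi>/2\<close>, where all sines are bounded by \<open>1\<close>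
  and the factor \<open>sin t\<close> equals \<open>1\<close>.\<close>
lemma integral_square_poly_ge:
  fixes r :: "real poly"
  assumes "degree r < m" "0 < \<epsilon>"
  shows "integral {x - \<epsilon>..x + \<epsilon>} (\<lambda>y. (poly r y)\<^sup>2) \<ge> \<epsilon> * pi / (2 * real m) * (poly r x)\<^sup>2"
proof -
  define q where "q = pcompose r [:x, -\<epsilon>:]"
  have q: "poly q u = poly r (x - \<epsilon> * u)" for u by (simp add: q_def poly_pcompose algebra_simps)
  have "degree q < m" using assms(1) by (simp add: q_def degree_pcompose)
  then obtain c where c: "q = (\<Sum>k<m. smult (c k) (chebyshev_U k))"
    using expand_in_graded_basis[of chebyshev_U m q] degree_chebyshev_U
    by (metis coeff_eq_0 order_less_le_trans)
  have sine: "poly q (cos t) * sin t = (\<Sum>k<m. c k * sin (real (Suc k) * t))" for t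
    by (subst c) (simp only: poly_sum poly_smult sum_distrib_right mult.assoc chebyshev_U_cos)
  have "poly r x = (\<Sum>k<m. c k * sin (real (Suc k) * (pi / 2)))"
    using sine[of "pi / 2"] by (simp add: q)
  then have "(poly r x)\<^sup>2 \<le> (\<Sum>k<m. (c k)\<^sup>2) * (\<Sum>k<m. (sin (real (Suc k) * (pi / 2)))\<^sup>2)"
    using Cauchy_Schwarz_ineq_sum by metis
  also have "\<dots> \<le> (\<Sum>k<m. (c k)\<^sup>2) * (\<Sum>k<m. 1)"
    by (intro mult_left_mono sum_mono sum_nonneg) (auto simp: abs_square_le_1)
  finally have val: "(poly r x)\<^sup>2 \<le> real m * (\<Sum>k<m. (c k)\<^sup>2)" by (simp add: mult.commute)
  have m: "m > 0" using assms(1) by simp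
  have "\<epsilon> * pi / (2 * real m) * (poly r x)\<^sup>2 \<le> \<epsilon> * pi / (2 * real m) * (real m * (\<Sum>k<m. (c k)\<^sup>2))"
    using assms(2) m by (intro mult_left_mono val) auto
  also have "\<dots> = \<epsilon> * (pi / 2 * (\<Sum>k<m. (c k)\<^sup>2))" using m by simp
  also have "\<dots> \<le> integral {x - \<epsilon> * cos 0..x - \<epsilon> * cos pi} (\<lambda>y. (poly r y)\<^sup>2)"
  proof (rule has_integral_le)
    show "((\<lambda>t. \<epsilon> * (\<Sum>k<m. c k * sin (real (Suc k) * t))\<^sup>2) has_integral \<epsilon> * (pi / 2 * (\<Sum>k<m. (c k)\<^sup>2))) {0..pi}"
      by (intro has_integral_mult_right has_integral_square_sine_poly)
    show "((\<lambda>t. (\<epsilon> * sin t) *\<^sub>R (poly r (x - \<epsilon> * cos t))\<^sup>2) has_integral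
        integral {x - \<epsilon> * cos 0..x - \<epsilon> * cos pi} (\<lambda>y. (poly r y)\<^sup>2)) {0..pi}"
    proof (rule has_integral_substitution[where c = "x - \<epsilon>" and d = "x + \<epsilon>"])
      show "(\<lambda>t. x - \<epsilon> * cos t) ` {0..pi} \<subseteq> {x - \<epsilon>..x + \<epsilon>}"
      proof safe
        fix t
        show "x - \<epsilon> * cos t \<in> {x - \<epsilon>..x + \<epsilon>}"
          using assms(2) mult_left_mono[OF cos_le_one[of t], of \<epsilon>]
            mult_left_mono[OF cos_ge_minus_one[of t], of \<epsilon>] by simp
      qed
    qed (use assms(2) in \<open>auto intro!: derivative_eq_intros continuous_intros\<close>)
    show "\<epsilon> * (\<Sum>k<m. c k * sin (real (Suc k) * t))\<^sup>2 \<le> (\<epsilon> * sin t) *\<^sub>R (poly r (x - \<epsilon> * cos t))\<^sup>2"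
      if "t \<in> {0..pi}" for t
    proof -
      have "(sin t)\<^sup>2 \<le> sin t"
        using sin_ge_zero[of t] sin_le_one[of t] that by (simp add: power2_eq_square mult_left_le)
      then have "\<epsilon> * (poly q (cos t))\<^sup>2 * (sin t)\<^sup>2 \<le> \<epsilon> * (poly q (cos t))\<^sup>2 * sin t"
        using assms(2) by (intro mult_left_mono) auto
      then show ?thesis unfolding sine[symmetric] by (simp add: q power_mult_distrib mult_ac)
    qed
  qed
  finally show ?thesis by simp
qed

text \<open>Dropping the singular part of \<open>\<mu>\<close> only decreases the integral of a nonnegative function.\<close>
lemma integral_ge_of_density:
  assumes "sets \<mu> = sets borel" "is_ac_density \<mu> w" "0 < \<delta>"
    and w: "AE x in lborel. x \<in> {l..u} \<longrightarrow> ennreal \<delta> \<le> w x"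
    and f: "integrable \<mu> f" "continuous_on UNIV f" "\<And>x. 0 \<le> (f x :: real)"
  shows "\<delta> * integral {l..u} f \<le> (\<integral>x. f x \<partial>\<mu>)"
proof -
  obtain \<nu> where wm: "w \<in> borel_measurable borel"
    and \<nu>: "\<And>A. A \<in> sets borel \<Longrightarrow> emeasure \<mu> A = emeasure (density lborel w) A + emeasure \<nu> A"
    using assms(2) unfolding is_ac_density_def by blast
  have fm: "f \<in> borel_measurable borel" using f(2) by (rule borel_measurable_continuous_onI)
  have "density lborel w \<le> \<mu>"
    using assms(1) \<nu> by (subst le_measure) (auto simp: le_iff_add)
  then have "(\<integral>\<^sup>+x. ennreal (f x) \<partial>density lborel w) \<le> (\<integral>\<^sup>+x. ennreal (f x) \<partial>\<mu>)"
    using assms(1) by (intro nn_integral_mono_measure) auto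
  also have "\<dots> = ennreal (\<integral>x. f x \<partial>\<mu>)"
    using f by (intro nn_integral_eq_integral) auto
  finally have 1: "(\<integral>\<^sup>+x. w x * ennreal (f x) \<partial>lborel) \<le> ennreal (\<integral>x. f x \<partial>\<mu>)"
    using wm fm by (subst (asm) nn_integral_density) auto
  have int: "(\<lambda>x. \<delta> * f x) integrable_on {l..u}"
    by (intro integrable_continuous_interval continuous_intros continuous_on_subset[OF f(2)]) auto
  have "((\<lambda>x. if x \<in> {l..u} then \<delta> * f x else 0) has_integral (\<delta> * integral {l..u} f)) UNIV"
    using integrable_integral[OF int] by (subst has_integral_restrict_UNIV) simp
  then have "ennreal (\<delta> * integral {l..u} f) = (\<integral>\<^sup>+x. ennreal (if x \<in> {l..u} then \<delta> * f x else 0) \<partial>lborel)"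
    using assms(3) f(3) fm by (intro nn_integral_has_integral_lborel[symmetric]) auto
  also have "\<dots> \<le> (\<integral>\<^sup>+x. w x * ennreal (f x) \<partial>lborel)"
  proof (rule nn_integral_mono_AE)
    show "AE x in lborel. ennreal (if x \<in> {l..u} then \<delta> * f x else 0) \<le> w x * ennreal (f x)"
      using w assms(3) f(3) by (auto elim!: eventually_mono simp: ennreal_mult intro!: mult_right_mono)
  qed
  also note 1
  finally have "ennreal (\<delta> * integral {l..u} f) \<le> ennreal (\<integral>x. f x \<partial>\<mu>)" .
  then show ?thesis using f(3) by (simp add: ennreal_le_iff integral_nonneg)
qed

section \<open>Zeros and quadrature of an Angelesco system\<close>

context angelesco
begin

sublocale m1: infinite_compact_measure \<mu>1 a1 b1
  by unfold_locales (use borel_measures infinite_support support_subset in auto)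

sublocale m2: infinite_compact_measure \<mu>2 a2 b2
  by unfold_locales (use borel_measures infinite_support support_subset in auto)

definition multi_orthogonal :: "nat \<Rightarrow> real poly \<Rightarrow> bool" where
  "multi_orthogonal n P \<longleftrightarrow>
     (\<forall>k<n. (\<integral>x. poly P x * x ^ k \<partial>\<mu>1) = 0) \<and> (\<forall>k<n. (\<integral>x. poly P x * x ^ k \<partial>\<mu>2) = 0)"

lemma multi_orthogonal_roots:
  assumes "multi_orthogonal n P" "P \<noteq> 0"
  shows "n \<le> card {x. a1 < x \<and> x < b1 \<and> poly P x = 0}" "n \<le> card {x. a2 < x \<and> x < b2 \<and> poly P x = 0}"
    and "2 * n \<le> degree P"
proof -
  let ?A = "{x. a1 < x \<and> x < b1 \<and> poly P x = 0}" and ?B = "{x. a2 < x \<and> x < b2 \<and> poly P x = 0}"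
  show A: "n \<le> card ?A" and B: "n \<le> card ?B"
    using assms intervals m1.orth_poly_many_roots[of n P] m2.orth_poly_many_roots[of n P]
    by (auto simp: multi_orthogonal_def)
  have fin: "finite {x. poly P x = 0}" using assms(2) by (rule poly_roots_finite)
  have "card ?A + card ?B = card (?A \<union> ?B)"
    using intervals by (intro card_Un_disjoint[symmetric] finite_subset[OF _ fin]) auto
  also have "\<dots> \<le> card {x. poly P x = 0}" by (intro card_mono fin) auto
  also have "\<dots> \<le> degree P" by (rule card_poly_roots_bound[OF assms(2)])
  finally show "2 * n \<le> degree P" using A B by simp
qed

text \<open>Existence and uniqueness behind the definite description. The \<open>2n\<close> linear conditions have a
  nonzero solution of degree at most \<open>2n\<close>, which must have degree \<open>2n\<close> by its number of zeros. The
  difference of two monic solutions satisfies the same conditions with a smaller degree, so it is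
  zero.\<close>
lemma multi_orth_poly_props:
  "degree (multi_orth_poly \<mu>1 \<mu>2 n) = 2 * n" "lead_coeff (multi_orth_poly \<mu>1 \<mu>2 n) = 1"
  "multi_orthogonal n (multi_orth_poly \<mu>1 \<mu>2 n)"
proof -
  let ?Q = "\<lambda>P. degree P = 2 * n \<and> lead_coeff P = 1 \<and> multi_orthogonal n P"
  define L where "L i p = (if i < n then (\<integral>x. poly (p * monom 1 i) x \<partial>\<mu>1)
                                    else (\<integral>x. poly (p * monom 1 (i - n)) x \<partial>\<mu>2))" for i p
  have "\<exists>p. p \<noteq> 0 \<and> degree p \<le> 2 * n \<and> (\<forall>i<2*n. L i p = 0)"
    by (rule exists_nonzero_poly_annihilated)
       (auto simp: L_def ring_distribs m1.integral_poly_add m1.integral_poly_smult m2.integral_poly_add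
          m2.integral_poly_smult simp del: poly_mult poly_add poly_smult)
  then obtain p where p: "p \<noteq> 0" "degree p \<le> 2 * n" "\<And>i. i < 2*n \<Longrightarrow> L i p = 0" by blast
  have orth: "multi_orthogonal n p"
    unfolding multi_orthogonal_def
  proof (intro conjI allI impI)
    fix k assume "k < n"
    then show "(\<integral>x. poly p x * x ^ k \<partial>\<mu>1) = 0" "(\<integral>x. poly p x * x ^ k \<partial>\<mu>2) = 0"
      using p(3)[of k] p(3)[of "n + k"] by (auto simp: L_def poly_mult[abs_def] poly_monom[abs_def])
  qed
  define P where "P = smult (1 / lead_coeff p) p"
  have "?Q P"
    using multi_orthogonal_roots(3)[OF orth p(1)] p(1,2) orth
    by (auto simp: P_def multi_orthogonal_def)
  moreover have "P' = P''" if P': "?Q P'" and P'': "?Q P''" for P' P''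
  proof (rule ccontr)
    assume "P' \<noteq> P''"
    have int: "integrable \<mu>1 (\<lambda>x. poly P x * x ^ k)" "integrable \<mu>2 (\<lambda>x. poly P x * x ^ k)" for P k
      using m1.integrable_poly[of "P * monom 1 k"] m2.integrable_poly[of "P * monom 1 k"]
      by (simp_all add: poly_monom[abs_def] poly_mult[abs_def])
    have "multi_orthogonal n (P' - P'')"
      using P' P'' unfolding multi_orthogonal_def
      by (auto simp: left_diff_distrib Bochner_Integration.integral_diff[OF int(1) int(1)]
            Bochner_Integration.integral_diff[OF int(2) int(2)])
    then have deg: "2 * n \<le> degree (P' - P'')"
      using multi_orthogonal_roots(3) \<open>P' \<noteq> P''\<close> by simp
    have "coeff (P' - P'') i = 0" if "i \<ge> 2 * n" for i
      using P' P'' that by (cases "i = 2 * n") (auto simp: coeff_eq_0)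
    with deg have "lead_coeff (P' - P'') = 0" by blast
    then have "P' - P'' = 0" by (rule leading_coeff_0_iff[THEN iffD1])
    with \<open>P' \<noteq> P''\<close> show False by simp
  qed
  ultimately have "\<exists>!P. ?Q P" by blast
  then have "?Q (THE P. ?Q P)" by (rule theI')
  then have "?Q (multi_orth_poly \<mu>1 \<mu>2 n)"
    unfolding multi_orth_poly_def multi_orthogonal_def .
  then show "degree (multi_orth_poly \<mu>1 \<mu>2 n) = 2 * n" "lead_coeff (multi_orth_poly \<mu>1 \<mu>2 n) = 1"
  "multi_orthogonal n (multi_orth_poly \<mu>1 \<mu>2 n)" by auto
qed

abbreviation node :: "nat \<Rightarrow> nat \<Rightarrow> real" where
  "node \<equiv> multi_orth_zero \<mu>1 \<mu>2"

text \<open>The two intervals contain at least \<open>n\<close> zeros each, and \<open>2n\<close> is the degree. So these are all the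
  zeros, and listing them in increasing order puts those in the left interval first.\<close>
lemma
  shows node_less: "\<And>i k. 1 \<le> i \<Longrightarrow> i < k \<Longrightarrow> k \<le> 2 * n \<Longrightarrow> node n i < node n k"
    and node_right: "\<And>k. n < k \<Longrightarrow> k \<le> 2 * n \<Longrightarrow> a2 < node n k \<and> node n k < b2"
    and poly_node: "\<And>k. 1 \<le> k \<Longrightarrow> k \<le> 2 * n \<Longrightarrow> poly (multi_orth_poly \<mu>1 \<mu>2 n) (node n k) = 0"
proof -
  define P where "P = multi_orth_poly \<mu>1 \<mu>2 n"
  let ?A = "{x. a1 < x \<and> x < b1 \<and> poly P x = 0}" and ?B = "{x. a2 < x \<and> x < b2 \<and> poly P x = 0}"
  let ?R = "{x. poly P x = 0}"
  have "P \<noteq> 0" using multi_orth_poly_props(2)[of n] by (auto simp: P_def)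
  then have fin: "finite ?R" by (rule poly_roots_finite)
  have finA: "finite ?A" and finB: "finite ?B" by (auto intro: finite_subset[OF _ fin])
  have "n \<le> card ?A" "n \<le> card ?B"
    using multi_orthogonal_roots(1,2)[OF multi_orth_poly_props(3)] \<open>P \<noteq> 0\<close> by (auto simp: P_def)
  moreover have un: "card (?A \<union> ?B) = card ?A + card ?B"
    using intervals by (intro card_Un_disjoint finA finB) auto
  moreover have "card ?R \<le> 2 * n"
    using card_poly_roots_bound[OF \<open>P \<noteq> 0\<close>] by (simp add: P_def multi_orth_poly_props(1))
  moreover have "card (?A \<union> ?B) \<le> card ?R" by (intro card_mono fin) auto
  ultimately have cards: "card ?A = n" "card ?B = n" "card (?A \<union> ?B) = card ?R" by linarith+
  then have R: "?R = ?A \<union> ?B" by (intro card_subset_eq[symmetric] fin) auto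
  let ?a = "sorted_list_of_set ?A" and ?b = "sorted_list_of_set ?B"
  have "sorted_list_of_set ?R = ?a @ ?b"
  proof (rule sorted_distinct_set_unique)
    show "sorted (?a @ ?b)" "distinct (?a @ ?b)"
      using finA finB intervals by (auto simp: sorted_append intro: less_imp_le)
    show "set (sorted_list_of_set ?R) = set (?a @ ?b)"
      using finA finB fin by (subst R) simp
  qed auto
  then have node: "node n k = (?a @ ?b) ! (k - 1)" for k
    by (simp add: multi_orth_zero_def P_def)
  have len: "length ?a = n" "length ?b = n" using cards by simp_all
  have left: "node n k \<in> ?A" if "1 \<le> k" "k \<le> n" for k
    using nth_mem[of "k - 1" ?a] that len finA unfolding node by (auto simp: nth_append)
  have right: "node n k \<in> ?B" if "n < k" "k \<le> 2 * n" for k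
    using nth_mem[of "k - 1 - n" ?b] that len finB unfolding node by (auto simp: nth_append)
  show "a2 < node n k \<and> node n k < b2" if "n < k" "k \<le> 2 * n" for k
    using right[OF that] by simp
  show "poly (multi_orth_poly \<mu>1 \<mu>2 n) (node n k) = 0" if "1 \<le> k" "k \<le> 2 * n" for k
    using left[of k] right[of k] that by (cases "k \<le> n") (auto simp: P_def)
  show "node n i < node n k" if "1 \<le> i" "i < k" "k \<le> 2 * n" for i k
  proof -
    have "sorted_wrt (<) (sorted_list_of_set ?R)" by simp
    moreover have "card ?R = 2 * n"
      using cards un by linarith
    then have "length (sorted_list_of_set ?R) = 2 * n" by simp
    ultimately show ?thesis
      using that sorted_wrt_nth_less[of "(<)" "sorted_list_of_set ?R" "i - 1" "k - 1"]
      by (simp add: multi_orth_zero_def P_def)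
  qed
qed

lemma inj_on_node: "inj_on (node n) {1..2 * n}"
  by (rule strict_mono_on_imp_inj_on) (auto simp: strict_mono_on_def node_less)

lemma poly_eq_on_nodes:
  assumes "\<And>i. i \<in> {1..2 * n} \<Longrightarrow> poly p (node n i) = poly q (node n i)" "degree p < 2 * n" "degree q < 2 * n"
  shows "p = q"
  using assms card_image[OF inj_on_node, of n]
  by (intro poly_eqI_degree[of "node n ` {1..2 * n}"]) auto

lemma fundamental_poly_props:
  assumes "k \<in> {1..2 * n}"
  shows "degree (fundamental_poly \<mu>1 \<mu>2 n k) \<le> 2 * n - 1"
    and "i \<in> {1..2 * n} \<Longrightarrow> poly (fundamental_poly \<mu>1 \<mu>2 n k) (node n i) = (if i = k then 1 else 0)"
proof -
  let ?Q = "\<lambda>l. degree l \<le> 2 * n - 1 \<and> (\<forall>i\<in>{1..2 * n}. poly l (node n i) = (if i = k then 1 else 0))"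
  define p where "p = (\<Prod>i\<in>{1..2*n}-{k}. [:- node n i, 1:])"
  have p0: "poly p (node n i) = 0 \<longleftrightarrow> i \<noteq> k" if "i \<in> {1..2 * n}" for i
    using inj_onD[OF inj_on_node, of n] that assms by (auto simp: p_def poly_prod)
  have "degree p = 2 * n - 1"
    using assms by (simp add: p_def degree_prod_eq_sum_degree)
  then have "?Q (smult (1 / poly p (node n k)) p)" using p0 assms by auto
  moreover have "l = l'" if "?Q l" "?Q l'" for l l'
    using that assms by (intro poly_eq_on_nodes[of n]) auto
  ultimately have "\<exists>!l. ?Q l" by blast
  then have "?Q (THE l. ?Q l)" by (rule theI')
  then have "?Q (fundamental_poly \<mu>1 \<mu>2 n k)" by (simp add: fundamental_poly_def)
  then show "degree (fundamental_poly \<mu>1 \<mu>2 n k) \<le> 2 * n - 1"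
    "i \<in> {1..2 * n} \<Longrightarrow> poly (fundamental_poly \<mu>1 \<mu>2 n k) (node n i) = (if i = k then 1 else 0)" by auto
qed

text \<open>As for Gauss quadrature: \<open>R\<close> differs from its interpolating polynomial \<open>S\<close> at the nodes by a
  multiple of \<open>P\<close>, and the cofactor has degree at most \<open>3n - 1 - 2n = n - 1\<close>.\<close>
lemma quadrature_exact:
  assumes "1 \<le> n" "degree R \<le> 3 * n - 1"
  shows "(\<integral>x. poly R x \<partial>\<mu>1) = (\<Sum>k\<in>{1..2 * n}. quadrature_weight \<mu>1 \<mu>2 \<mu>1 n k * poly R (node n k))"
proof -
  define P where "P = multi_orth_poly \<mu>1 \<mu>2 n"
  define S where "S = (\<Sum>k\<in>{1..2 * n}. smult (poly R (node n k)) (fundamental_poly \<mu>1 \<mu>2 n k))"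
  have "P \<noteq> 0" using multi_orth_poly_props(2)[of n] by (auto simp: P_def)
  have degS: "degree S \<le> 2 * n - 1"
    unfolding S_def using fundamental_poly_props(1)
    by (intro degree_sum_le) (auto intro: order.trans[OF degree_smult_le])
  have S: "poly S (node n i) = poly R (node n i)" if "i \<in> {1..2 * n}" for i
    using that by (simp add: S_def poly_sum fundamental_poly_props(2) if_distrib cong: if_cong)
  define D where "D = R - S"
  have degD: "degree D \<le> 3 * n - 1"
    unfolding D_def using degS assms by (intro degree_diff_le) auto
  have D: "D = P * (D div P) + D mod P" by simp
  have "D mod P = 0"
  proof (rule poly_eq_on_nodes[of n])
    fix i assume i: "i \<in> {1..2 * n}"
    then have "poly P (node n i) = 0" using poly_node by (auto simp: P_def)
    moreover have "poly D (node n i) = 0" using S[OF i] by (simp add: D_def)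
    moreover have "poly D (node n i) = poly P (node n i) * poly (D div P) (node n i) + poly (D mod P) (node n i)"
      by (metis D poly_add poly_mult)
    ultimately show "poly (D mod P) (node n i) = poly 0 (node n i)" by simp
  next
    show "degree (D mod P) < 2 * n"
      using degree_mod_less[OF \<open>P \<noteq> 0\<close>, of D] assms(1) by (auto simp: P_def multi_orth_poly_props(1))
  qed (use assms in auto)
  then have DQ: "D = P * (D div P)" using D by simp
  have "coeff (D div P) k = 0" if "k \<ge> n" for k
  proof (cases "D div P = 0")
    case False
    then have "degree D = 2 * n + degree (D div P)"
      using degree_mult_eq[OF \<open>P \<noteq> 0\<close> False] DQ by (simp add: P_def multi_orth_poly_props(1))
    with degD that assms show ?thesis by (intro coeff_eq_0) auto
  qed simp
  then have "(\<integral>x. poly (P * (D div P)) x \<partial>\<mu>1) = 0"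
    using multi_orth_poly_props(3)[of n] by (intro m1.orth_lower_degree[of n]) (auto simp: P_def multi_orthogonal_def)
  then have "(\<integral>x. poly R x \<partial>\<mu>1) = (\<integral>x. poly S x \<partial>\<mu>1)"
    using m1.integral_poly_diff[of R S] DQ[symmetric] unfolding D_def by simp
  also have "\<dots> = (\<Sum>k\<in>{1..2 * n}. quadrature_weight \<mu>1 \<mu>2 \<mu>1 n k * poly R (node n k))"
    unfolding S_def m1.integral_poly_sum m1.integral_poly_smult by (simp add: quadrature_weight_def mult.commute)
  finally show ?thesis .
qed

text \<open>Of the test polynomial \<open>p\<^sup>2 q\<close> only the value at \<open>x\<^sub>k\<close> survives in the quadrature sum. The linear
  factors of \<open>q\<close> are written as \<open>x\<^sub>i - x\<close> to make \<open>q\<close> positive on the left interval. At \<open>x\<^sub>k\<close>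
  exactly the \<open>k - n - 1\<close> factors with \<open>n < i < k\<close> are negative, an odd number.\<close>
lemma quadrature_weight_nonpos:
  assumes "n < k" "k \<le> 2 * n" "even (k - n)"
  shows "quadrature_weight \<mu>1 \<mu>2 \<mu>1 n k \<le> 0"
proof -
  define p where "p = (\<Prod>i\<in>{1..n}. [:- node n i, 1:])"
  define q where "q = (\<Prod>i\<in>{n<..2*n}-{k}. [:node n i, -1:])"
  have "1 \<le> n" using assms by simp
  have "degree p = n" by (simp add: p_def degree_prod_eq_sum_degree)
  moreover have "degree q = n - 1" using assms by (simp add: q_def degree_prod_eq_sum_degree)
  ultimately have deg: "degree (p * p * q) \<le> 3 * n - 1"
    using degree_mult_le[of "p * p" q] degree_mult_le[of p p] \<open>1 \<le> n\<close> by linarith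
  have pq0: "poly (p * p * q) (node n i) = 0" if "i \<in> {1..2 * n} - {k}" for i
    using that by (cases "i \<le> n") (auto simp: p_def q_def poly_prod)
  have qpos: "0 \<le> poly q x" if "x \<le> b1" for x
    unfolding q_def poly_prod using that intervals node_right[of n]
    by (intro prod_nonneg) (force simp: algebra_simps)
  have "0 \<le> (\<integral>x. poly (p * p * q) x \<partial>\<mu>1)"
    by (intro integral_nonneg_AE eventually_mono[OF m1.AE_interval]) (auto simp: qpos)
  also have "\<dots> = (\<Sum>i\<in>{1..2 * n}. quadrature_weight \<mu>1 \<mu>2 \<mu>1 n i * poly (p * p * q) (node n i))"
    by (rule quadrature_exact[OF \<open>1 \<le> n\<close> deg])
  also have "\<dots> = quadrature_weight \<mu>1 \<mu>2 \<mu>1 n k * poly (p * p * q) (node n k)"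
  proof -
    have "(\<Sum>i\<in>{1..2 * n} - {k}. quadrature_weight \<mu>1 \<mu>2 \<mu>1 n i * poly (p * p * q) (node n i)) = 0"
      by (intro sum.neutral ballI) (simp only: pq0 mult_zero_right)
    then show ?thesis using assms by (subst sum.remove[of _ k]) auto
  qed
  finally have 1: "0 \<le> quadrature_weight \<mu>1 \<mu>2 \<mu>1 n k * poly (p * p * q) (node n k)" .
  have "poly p (node n k) \<noteq> 0"
    using node_less[of _ k n] assms by (fastforce simp: p_def poly_prod)
  moreover have "poly q (node n k) < 0"
  proof -
    have set: "{n<..2*n}-{k} = {n<..<k} \<union> {k<..2*n}" using assms by auto
    have "poly q (node n k) = (\<Prod>i\<in>{n<..<k}. node n i - node n k) * (\<Prod>i\<in>{k<..2*n}. node n i - node n k)"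
      unfolding q_def set poly_prod by (subst prod.union_disjoint) auto
    also have "(\<Prod>i\<in>{n<..<k}. node n i - node n k) = (\<Prod>i\<in>{n<..<k}. (- 1) * (node n k - node n i))" by simp
    also have "\<dots> = (- 1) ^ (k - n - 1) * (\<Prod>i\<in>{n<..<k}. node n k - node n i)"
      by (subst prod.distrib) simp
    also have "odd (k - n - 1)" using assms by auto
    then have "(- 1) ^ (k - n - 1) = (- 1 :: real)" by simp
    finally have "poly q (node n k) = - ((\<Prod>i\<in>{n<..<k}. node n k - node n i) * (\<Prod>i\<in>{k<..2*n}. node n i - node n k))"
      by simp
    moreover have "(\<Prod>i\<in>{n<..<k}. node n k - node n i) * (\<Prod>i\<in>{k<..2*n}. node n i - node n k) > 0"
      using node_less[of _ _ n] assms by (intro mult_pos_pos prod_pos) auto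
    ultimately show ?thesis by simp
  qed
  ultimately have "poly (p * p * q) (node n k) < 0"
    by (auto simp: mult_less_0_iff zero_less_mult_iff not_less)
  with 1 show ?thesis by (auto simp: zero_le_mult_iff simp del: poly_mult)
qed

text \<open>The polynomial \<open>r\<close> kills every node other than \<open>x\<^sub>j\<close> whose weight may be positive.\<close>
lemma exists_test_poly:
  assumes "1 \<le> j" "j \<le> n"
  obtains r where "degree r < nat \<lceil>3 * real n / 2\<rceil>" "poly r (node n j) = 1"
    "(\<integral>x. poly (r * r) x \<partial>\<mu>1) \<le> quadrature_weight \<mu>1 \<mu>2 \<mu>1 n j"
proof -
  define N where "N = ({1..n} - {j}) \<union> {k\<in>{n<..2*n}. odd (k - n)}"
  define p where "p = (\<Prod>i\<in>N. [:- node n i, 1:])"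
  define r where "r = smult (1 / poly p (node n j)) p"
  have N: "finite N" "N \<subseteq> {1..2 * n}" "j \<notin> N" using assms by (auto simp: N_def)
  have "bij_betw (\<lambda>i. n + 2 * i + 1) {..<(n + 1) div 2} {k\<in>{n<..2*n}. odd (k - n)}"
    by (rule bij_betw_byWitness[where f' = "\<lambda>k. (k - n) div 2"]) (auto elim!: oddE, presburger+)
  then have "card {k\<in>{n<..2*n}. odd (k - n)} = (n + 1) div 2"
    using bij_betw_same_card by fastforce
  then have "card N = (n - 1) + (n + 1) div 2"
    using assms unfolding N_def by (subst card_Un_disjoint) auto
  moreover have "degree p = card N" by (simp add: p_def degree_prod_eq_sum_degree)
  ultimately have degr: "degree r \<le> (n - 1) + (n + 1) div 2" by (simp add: r_def)
  have m: "nat \<lceil>3 * real n / 2\<rceil> = n + (n + 1) div 2"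
  proof (cases "even n")
    case True
    then obtain i where "n = 2 * i" by blast
    moreover have "\<lceil>3 * real (2 * i) / 2\<rceil> = 3 * int i" by (rule ceiling_unique) auto
    ultimately show ?thesis by simp
  next
    case False
    then obtain i where "n = 2 * i + 1" by (blast elim: oddE)
    moreover have "\<lceil>3 * real (2 * i + 1) / 2\<rceil> = 3 * int i + 2" by (rule ceiling_unique) auto
    ultimately show ?thesis by simp
  qed
  have "poly p (node n j) \<noteq> 0"
    using N assms inj_onD[OF inj_on_node, of n] by (fastforce simp: p_def poly_prod)
  then have rj: "poly r (node n j) = 1" by (simp add: r_def)
  have r0: "poly r (node n i) = 0" if "i \<in> N" for i
    using that N(1) by (auto simp: r_def p_def poly_prod)
  have "(n - 1) + (n + 1) div 2 + ((n - 1) + (n + 1) div 2) \<le> 3 * n - 1" using assms by linarith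
  then have "degree (r * r) \<le> 3 * n - 1"
    using degr degree_mult_le[of r r] by linarith
  then have "(\<integral>x. poly (r * r) x \<partial>\<mu>1)
      = (\<Sum>i\<in>{1..2 * n}. quadrature_weight \<mu>1 \<mu>2 \<mu>1 n i * poly (r * r) (node n i))"
    using assms by (intro quadrature_exact) auto
  also have "\<dots> = quadrature_weight \<mu>1 \<mu>2 \<mu>1 n j
      + (\<Sum>i\<in>{1..2 * n}-{j}. quadrature_weight \<mu>1 \<mu>2 \<mu>1 n i * poly (r * r) (node n i))"
    using assms rj by (subst sum.remove[of _ j]) auto
  also have "\<dots> \<le> quadrature_weight \<mu>1 \<mu>2 \<mu>1 n j + 0"
  proof (intro add_left_mono sum_nonpos)
    fix i assume i: "i \<in> {1..2 * n} - {j}"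
    show "quadrature_weight \<mu>1 \<mu>2 \<mu>1 n i * poly (r * r) (node n i) \<le> 0"
    proof (cases "i \<in> N")
      case False
      then have "quadrature_weight \<mu>1 \<mu>2 \<mu>1 n i \<le> 0"
        using i by (intro quadrature_weight_nonpos) (auto simp: N_def)
      then show ?thesis by (simp add: mult_nonpos_nonneg)
    qed (simp add: r0)
  qed
  finally show ?thesis using degr m rj assms by (intro that[of r]) auto
qed

end

section \<open>Lower bounds for the quadrature weights\<close>

theorem proposition2p4:
  fixes a1 b1 a2 b2 :: real and \<mu>1 \<mu>2 :: "real measure"
  assumes "angelesco a1 b1 a2 b2 \<mu>1 \<mu>2"
  shows "(\<forall>n\<ge>1. \<forall>j\<in>{1..n}.
            quadrature_weight \<mu>1 \<mu>2 \<mu>1 n j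
              \<ge> christoffel_fun (nat \<lceil>3 * real n / 2\<rceil>) (multi_orth_zero \<mu>1 \<mu>2 n j) \<mu>1)
       \<and> (\<forall>c d U w \<delta>.
            a1 < c \<and> c \<le> d \<and> d < b1 \<and> open U \<and> {c..d} \<subseteq> U \<and>
            absolutely_continuous (restrict_space lborel U) (restrict_space \<mu>1 U) \<and>
            is_ac_density \<mu>1 w \<and> 0 < (\<delta>::real) \<and> (AE x in lborel. x \<in> U \<longrightarrow> ennreal \<delta> \<le> w x)
            \<longrightarrow> (\<exists>C1>0. \<forall>n\<ge>1. \<forall>j\<in>{1..n}.
                  multi_orth_zero \<mu>1 \<mu>2 n j \<in> {c..d}
                  \<longrightarrow> quadrature_weight \<mu>1 \<mu>2 \<mu>1 n j \<ge> C1 / real n))"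
proof (intro conjI allI impI ballI, goal_cases)
  interpret angelesco a1 b1 a2 b2 \<mu>1 \<mu>2 by (rule assms)
  case (1 n j)
  obtain r where r: "degree r < nat \<lceil>3 * real n / 2\<rceil>" "poly r (node n j) = 1"
    "(\<integral>x. poly (r * r) x \<partial>\<mu>1) \<le> quadrature_weight \<mu>1 \<mu>2 \<mu>1 n j"
    using exists_test_poly[of j n] 1 by auto
  have "christoffel_fun (nat \<lceil>3 * real n / 2\<rceil>) (node n j) \<mu>1 \<le> (\<integral>x. poly (r * r) x \<partial>\<mu>1)"
    using r intervals by (intro m1.christoffel_fun_le) auto
  with r(3) show ?case by simp
next
  interpret angelesco a1 b1 a2 b2 \<mu>1 \<mu>2 by (rule assms)
  case (2 c d U w \<delta>)
  then have U: "open U" "{c..d} \<subseteq> U" and dens: "is_ac_density \<mu>1 w" and "0 < \<delta>"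
    and w: "AE x in lborel. x \<in> U \<longrightarrow> ennreal \<delta> \<le> w x" by auto
  obtain e where e: "0 < e" "(\<Union>x\<in>{c..d}. ball x e) \<subseteq> U"
    using compact_subset_open_imp_ball_epsilon_subset[OF compact_Icc U] by blast
  define \<epsilon> where "\<epsilon> = e / 2"
  have "0 < \<epsilon>" using e by (simp add: \<epsilon>_def)
  have nbhd: "{x - \<epsilon>..x + \<epsilon>} \<subseteq> U" if "x \<in> {c..d}" for x
    using e that by (force simp: \<epsilon>_def dist_real_def)
  \<comment> \<open>The lower bound \<open>\<delta> \<epsilon> \<pi> / (2m)\<close> is used with \<open>m \<le> 2n\<close>.\<close>
  show ?case
  proof (intro exI[of _ "\<delta> * \<epsilon> * pi / 4"] conjI allI impI ballI)
    show "0 < \<delta> * \<epsilon> * pi / 4" using \<open>0 < \<delta>\<close> \<open>0 < \<epsilon>\<close> by simp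
  next
    fix n j assume nj: "1 \<le> n" "j \<in> {1..n}" "node n j \<in> {c..d}"
    define m where "m = nat \<lceil>3 * real n / 2\<rceil>"
    obtain r where r: "degree r < m" "poly r (node n j) = 1"
      "(\<integral>x. poly (r * r) x \<partial>\<mu>1) \<le> quadrature_weight \<mu>1 \<mu>2 \<mu>1 n j"
      using exists_test_poly[of j n] nj unfolding m_def by auto
    have "\<lceil>3 * real n / 2\<rceil> \<le> 2 * int n" by (simp add: ceiling_le_iff)
    then have m: "0 < m" "real m \<le> 2 * real n" using r(1) by (auto simp: m_def)
    have "\<delta> * \<epsilon> * pi / 4 / real n = \<delta> * (\<epsilon> * pi / (2 * (2 * real n)))" by simp
    also have "\<dots> \<le> \<delta> * (\<epsilon> * pi / (2 * real m))"
      using m nj \<open>0 < \<delta>\<close> \<open>0 < \<epsilon>\<close> by (intro mult_left_mono divide_left_mono) auto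
    also have "\<dots> \<le> \<delta> * integral {node n j - \<epsilon>..node n j + \<epsilon>} (poly (r * r))"
      using integral_square_poly_ge[OF r(1) \<open>0 < \<epsilon>\<close>, of "node n j"] r(2) \<open>0 < \<delta>\<close>
      by (intro mult_left_mono) (auto simp: poly_mult[abs_def] power2_eq_square)
    also have "\<dots> \<le> (\<integral>x. poly (r * r) x \<partial>\<mu>1)"
    proof (rule integral_ge_of_density[OF borel_measures(1) dens \<open>0 < \<delta>\<close>])
      show "AE x in lborel. x \<in> {node n j - \<epsilon>..node n j + \<epsilon>} \<longrightarrow> ennreal \<delta> \<le> w x"
        using w nbhd[OF nj(3)] by (auto elim!: eventually_mono)
    next
      show "continuous_on UNIV (poly (r * r))" by (rule continuous_on_poly[OF continuous_on_id])
      show "0 \<le> poly (r * r) x" for x by simp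
    qed (rule m1.integrable_poly)
    also note r(3)
    finally show "\<delta> * \<epsilon> * pi / 4 / real n \<le> quadrature_weight \<mu>1 \<mu>2 \<mu>1 n j" .
  qed
qed

end
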